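(* Fix $0<p<1$. Fix $\tau,\kappa\ge0$ with $\kappa>\tau/p$, and suppose $t(n)/\ln n\to\tau$ as $n\to\infty$ and $k(n)\sim\kappa\ln n$ (with $t(n)$, $k(n)$ non-negative integers). Let $\mathcal{S}_{n,t,k}$ be the collection of $t$-dependent $k$-sets in $G_{n,p}$. Then \[ \mathbb{E}(|\mathcal{S}_{n,t,k}|)=\exp\left(k\ln n\left(1-\frac{\kappa}{2}\Lambda^*\!\left(\frac{\tau}{\kappa}\right)+o(1)\right)\right). \]
   Context: $G_{n,p}$ is the Erdős–Rényi random graph on $\{1,\dots,n\}$ with independent edge probability $p$. A vertex set is $t$-dependent if it induces a subgraph of maximum degree at most $t$; a $k$-set is a set of $k$ vertices. With $q=1-p$, $\Lambda^*(x)=x\ln\frac{x}{p}+(1-x)\ln\frac{1-x}{q}$ for $x\in[0,1]$ (with $\Lambda^*(0)=\ln(1/q)$, $\Lambda^*(1)=\ln(1/p)$), $\Lambda^*(x)=\infty$ otherwise. The $o(1)$ is as $n\to\infty$. *)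

theory Defs
  imports "HOL-Probability.Probability" "HOL-Library.Landau_Symbols"
begin

text \<open>A graph on the vertex set \<open>{1..n}\<close> is given by its set of edges, the edges being
  two-element subsets of \<open>{1..n}\<close>.\<close>

definition all_edges :: "nat \<Rightarrow> nat set set" where
  "all_edges n = {e. e \<subseteq> {1..n} \<and> card e = 2}"

definition gnp :: "nat \<Rightarrow> real \<Rightarrow> nat set set pmf" where
  "gnp n p = map_pmf (\<lambda>f. {e \<in> all_edges n. f e})
     (Pi_pmf (all_edges n) False (\<lambda>_. bernoulli_pmf p))"

definition induced_edges :: "nat set set \<Rightarrow> nat set \<Rightarrow> nat set set" where
  "induced_edges E S = {e \<in> E. e \<subseteq> S}"

definition vdegree :: "nat set set \<Rightarrow> nat \<Rightarrow> nat" where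
  "vdegree E v = card {e \<in> E. v \<in> e}"

definition t_dependent :: "nat set set \<Rightarrow> nat \<Rightarrow> nat set \<Rightarrow> bool" where
  "t_dependent E t S \<longleftrightarrow> (\<forall>v\<in>S. vdegree (induced_edges E S) v \<le> t)"

definition dependent_sets :: "nat \<Rightarrow> nat \<Rightarrow> nat \<Rightarrow> nat set set \<Rightarrow> nat set set" where
  "dependent_sets n t k E = {S. S \<subseteq> {1..n} \<and> card S = k \<and> t_dependent E t S}"

definition Lambda_star :: "real \<Rightarrow> real \<Rightarrow> ereal" where
  "Lambda_star p x =
    (if x = 0 then ereal (ln (1 / (1 - p)))
     else if x = 1 then ereal (ln (1 / p))
     else if 0 < x \<and> x < 1 then ereal (x * ln (x / p) + (1 - x) * ln ((1 - x) / (1 - p)))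
     else \<infinity>)"

end

theory Submission
  imports Defs
begin

text \<open>
  By linearity the expectation is \<open>n choose k\<close> times the probability that a given \<open>k\<close>-set is
  \<open>t\<close>-dependent, and \<open>ln (n choose k) \<sim> k ln n\<close>. Put \<open>x = \<tau> / \<kappa>\<close>, so \<open>t / k \<rightarrow> x < p\<close>.

  Upper bound: a \<open>t\<close>-dependent \<open>k\<close>-set spans at most \<open>t k / 2\<close> edges, so the Chernoff bound for
  the number of edges applies. Lower bound: tilt the edge probability to some \<open>r\<close> slightly below
  \<open>x\<close>. Under the tilted measure all degrees are at most \<open>t\<close> with probability tending to 1 (Chernoff
  and a union bound), and the mean log-likelihood ratio is \<open>-\<Lambda>\<^sup>*(r)\<close> per potential edge. For
  \<open>x = 0\<close> the empty graph alone suffices.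
\<close>

section \<open>Potential edges inside a vertex set, and degree counting\<close>

definition pairs :: "'a set \<Rightarrow> 'a set set" where
  "pairs S = {e. e \<subseteq> S \<and> card e = 2}"

lemma all_edges_eq_pairs: "all_edges n = pairs {1..n}"
  by (simp add: all_edges_def pairs_def)

lemma finite_pairs [simp]: "finite S \<Longrightarrow> finite (pairs S)"
  unfolding pairs_def by (rule finite_subset[of _ "Pow S"]) auto

lemma card_pairs: "finite S \<Longrightarrow> card (pairs S) = card S choose 2"
  unfolding pairs_def by (rule n_subsets)

lemma pairs_mono: "S \<subseteq> T \<Longrightarrow> pairs S \<subseteq> pairs T"
  by (auto simp: pairs_def)

lemma card_pairs_containing:
  assumes "finite S" "v \<in> S"
  shows "card {e \<in> pairs S. v \<in> e} = card S - 1"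
proof -
  have "{e \<in> pairs S. v \<in> e} = (\<lambda>u. {u, v}) ` (S - {v})"
  proof (intro equalityI subsetI)
    fix e assume "e \<in> {e \<in> pairs S. v \<in> e}"
    hence e: "e \<subseteq> S" "card e = 2" "v \<in> e" by (auto simp: pairs_def)
    then obtain x y where "e = {x, y}" "x \<noteq> y" by (auto simp: card_2_iff)
    with e show "e \<in> (\<lambda>u. {u, v}) ` (S - {v})" by (auto simp: insert_commute)
  next
    fix e assume "e \<in> (\<lambda>u. {u, v}) ` (S - {v})"
    thus "e \<in> {e \<in> pairs S. v \<in> e}" using assms by (auto simp: pairs_def)
  qed
  moreover have "inj_on (\<lambda>u. {u, v}) (S - {v})"
    by (auto simp: inj_on_def doubleton_eq_iff)
  ultimately show ?thesis using assms by (simp add: card_image)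
qed

text \<open>Handshake identity: count the incidences \<open>v \<in> e\<close> in both orders; every
  edge has exactly two endpoints, both in \<open>S\<close>.\<close>

lemma sum_vdegree:
  assumes "finite S" "E \<subseteq> pairs S"
  shows "(\<Sum>v\<in>S. vdegree E v) = 2 * card E"
proof -
  have fin: "finite E" using assms finite_pairs finite_subset by blast
  have "(\<Sum>v\<in>S. vdegree E v) = (\<Sum>v\<in>S. \<Sum>e\<in>E. if v \<in> e then 1 else 0)"
    unfolding vdegree_def using fin
    by (intro sum.cong refl) (simp add: sum.If_cases Int_def)
  also have "\<dots> = (\<Sum>e\<in>E. \<Sum>v\<in>S. if v \<in> e then 1 else 0)" by (rule sum.swap)
  also have "\<dots> = (\<Sum>e\<in>E. 2)"
  proof (rule sum.cong[OF refl])
    fix e assume "e \<in> E"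
    hence "S \<inter> {v. v \<in> e} = e" "card e = 2" using assms(2) by (auto simp: pairs_def)
    thus "(\<Sum>v\<in>S. if v \<in> e then 1 else 0) = (2::nat)"
      using assms(1) by (simp add: sum.If_cases)
  qed
  finally show ?thesis by simp
qed

section \<open>Binomial random subsets of a finite set\<close>

text \<open>The probability that a random subset of \<open>F\<close>, containing each element
  independently with probability \<open>p\<close>, equals \<open>E\<close>. With explicit weights,
  probabilities become finite sums, and changing \<open>p\<close> to another parameter is plain
  algebra.\<close>

definition subset_weight :: "'a set \<Rightarrow> real \<Rightarrow> 'a set \<Rightarrow> real" where
  "subset_weight F p E = p ^ card E * (1 - p) ^ card (F - E)"

lemma subset_weight_nonneg: "0 \<le> p \<Longrightarrow> p \<le> 1 \<Longrightarrow> 0 \<le> subset_weight F p E"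
  by (simp add: subset_weight_def)

text \<open>Multiply out the product: \<open>E\<close> records the factors contributing
  \<open>p * y e\<close>. This multivariate generating function yields the total mass, the mean size
  and both exponential-moment bounds below.\<close>

lemma sum_subset_weight_prod:
  assumes "finite F"
  shows "(\<Sum>E\<in>Pow F. subset_weight F p E * (\<Prod>e\<in>E. y e)) = (\<Prod>e\<in>F. 1 - p + p * y e)"
proof -
  have "(\<Prod>e\<in>F. 1 - p + p * y e) = (\<Prod>e\<in>F. p * y e + (1 - p))"
    by (simp add: add.commute)
  also have "\<dots> = (\<Sum>E\<in>Pow F. (\<Prod>e\<in>E. p * y e) * (\<Prod>e\<in>F - E. 1 - p))"
    by (rule prod_add[OF assms])
  also have "\<dots> = (\<Sum>E\<in>Pow F. subset_weight F p E * (\<Prod>e\<in>E. y e))"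
    by (simp add: prod.distrib subset_weight_def mult_ac)
  finally show ?thesis by simp
qed

lemma sum_subset_weight_power:
  assumes "finite F"
  shows "(\<Sum>E\<in>Pow F. subset_weight F p E * z ^ card E) = (1 - p + p * z) ^ card F"
  using sum_subset_weight_prod[OF assms, of p "\<lambda>_. z"] by simp

lemma sum_subset_weight: "finite F \<Longrightarrow> (\<Sum>E\<in>Pow F. subset_weight F p E) = 1"
  using sum_subset_weight_power[of F p 1] by simp

text \<open>The mean size is the derivative at \<open>z = 1\<close> of the generating function,
  computed once termwise and once from the closed form.\<close>

lemma sum_subset_weight_card:
  assumes "finite F"
  shows "(\<Sum>E\<in>Pow F. subset_weight F p E * card E) = p * card F"
proof -
  have "((\<lambda>z. \<Sum>E\<in>Pow F. subset_weight F p E * z ^ card E) has_field_derivative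
          (\<Sum>E\<in>Pow F. subset_weight F p E * card E)) (at 1)"
    by (auto intro!: derivative_eq_intros simp: mult.commute)
  moreover have "((\<lambda>z. (1 - p + p * z) ^ card F) has_field_derivative p * card F) (at 1)"
    by (auto intro!: derivative_eq_intros)
  ultimately show ?thesis
    unfolding sum_subset_weight_power[OF assms] by (rule DERIV_unique)
qed

section \<open>Reduction of the expectation to the probability for a single vertex set\<close>

definition bounded_degree_sets :: "nat \<Rightarrow> nat set \<Rightarrow> nat set set set" where
  "bounded_degree_sets t S = {E. E \<subseteq> pairs S \<and> (\<forall>v\<in>S. vdegree E v \<le> t)}"

text \<open>The probability that \<open>S\<close> is \<open>t\<close>-dependent when edges have
  probability \<open>p\<close>, as \<open>prob_t_dependent_gnp\<close> confirms. It involves only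
  pairs inside \<open>S\<close>, so the ambient \<open>n\<close> disappears.\<close>

definition dependence_prob :: "real \<Rightarrow> nat \<Rightarrow> nat set \<Rightarrow> real" where
  "dependence_prob p t S = (\<Sum>E\<in>bounded_degree_sets t S. subset_weight (pairs S) p E)"

lemma bounded_degree_sets_subset: "bounded_degree_sets t S \<subseteq> Pow (pairs S)"
  by (auto simp: bounded_degree_sets_def)

lemma finite_bounded_degree_sets: "finite S \<Longrightarrow> finite (bounded_degree_sets t S)"
  by (rule finite_subset[OF bounded_degree_sets_subset]) simp

text \<open>The edges induced on \<open>S\<close> depend only on the coins of the pairs inside
  \<open>S\<close>, and the restriction of a product measure to some coordinates is again the
  product measure on them.\<close>

lemma map_pmf_induced_edges_gnp:
  assumes "S \<subseteq> {1..n}"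
  shows "map_pmf (\<lambda>E. induced_edges E S) (gnp n p) =
    map_pmf (\<lambda>f. {e \<in> pairs S. f e}) (Pi_pmf (pairs S) False (\<lambda>_. bernoulli_pmf p))"
proof -
  have sub: "pairs S \<subseteq> all_edges n"
    unfolding all_edges_eq_pairs using assms by (rule pairs_mono)
  have "Pi_pmf (pairs S) False (\<lambda>_. bernoulli_pmf p) =
    map_pmf (\<lambda>f x. if x \<in> pairs S then f x else False) (Pi_pmf (all_edges n) False (\<lambda>_. bernoulli_pmf p))"
    by (rule Pi_pmf_subset) (use sub in \<open>simp_all add: all_edges_eq_pairs\<close>)
  hence "map_pmf (\<lambda>f. {e \<in> pairs S. f e}) (Pi_pmf (pairs S) False (\<lambda>_. bernoulli_pmf p)) =
    map_pmf (\<lambda>f. {e \<in> pairs S. f e}) (Pi_pmf (all_edges n) False (\<lambda>_. bernoulli_pmf p))"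
    by (simp add: map_pmf_comp cong: conj_cong)
  moreover have "induced_edges {e \<in> all_edges n. f e} S = {e \<in> pairs S. f e}" for f
    using sub by (auto simp: induced_edges_def pairs_def all_edges_def)
  ultimately show ?thesis by (simp add: gnp_def map_pmf_comp)
qed

lemma pmf_random_subset:
  assumes "finite F" "E \<subseteq> F" "0 \<le> p" "p \<le> 1"
  shows "pmf (map_pmf (\<lambda>f. {e \<in> F. f e}) (Pi_pmf F False (\<lambda>_. bernoulli_pmf p))) E
    = subset_weight F p E"
proof -
  let ?M = "Pi_pmf F False (\<lambda>_. bernoulli_pmf p)"
  have "pmf (map_pmf (\<lambda>f. {e \<in> F. f e}) ?M) E
      = measure_pmf.prob ?M ((\<lambda>f. {e \<in> F. f e}) -` {E})"
    by (simp add: pmf_map)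
  also have "\<dots> = measure_pmf.prob ?M {\<lambda>e. e \<in> E}"
  \<comment> \<open>Functions in the support take the default value \<open>False\<close> off
    \<open>F\<close>, so almost surely the subset of \<open>F\<close> determines the whole
    function.\<close>
  proof (rule measure_pmf.finite_measure_eq_AE)
    show "AE f in ?M. (f \<in> (\<lambda>f. {e \<in> F. f e}) -` {E}) = (f \<in> {\<lambda>e. e \<in> E})"
      using assms(1,2) set_Pi_pmf_subset[OF assms(1), of False "\<lambda>_. bernoulli_pmf p"]
      by (auto simp: AE_measure_pmf_iff fun_eq_iff)
  qed auto
  also have "\<dots> = pmf ?M (\<lambda>e. e \<in> E)" by (simp add: pmf.rep_eq)
  also have "\<dots> = (\<Prod>e\<in>F. pmf (bernoulli_pmf p) (e \<in> E))"
    using assms by (subst pmf_Pi) auto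
  also have "\<dots> = (\<Prod>e\<in>F. if e \<in> E then p else 1 - p)"
    using assms by (intro prod.cong) auto
  also have "\<dots> = subset_weight F p E"
    using assms by (simp add: prod.If_cases subset_weight_def Int_absorb1 Diff_eq)
  finally show ?thesis .
qed

lemma prob_t_dependent_gnp:
  assumes "S \<subseteq> {1..n}" "0 \<le> p" "p \<le> 1"
  shows "measure_pmf.prob (gnp n p) {E. t_dependent E t S} = dependence_prob p t S"
proof -
  let ?N = "map_pmf (\<lambda>f. {e \<in> pairs S. f e}) (Pi_pmf (pairs S) False (\<lambda>_. bernoulli_pmf p))"
  have fin: "finite S" using assms(1) finite_subset by blast
  have "measure_pmf.prob (gnp n p) {E. t_dependent E t S}
      = measure_pmf.prob (map_pmf (\<lambda>E. induced_edges E S) (gnp n p)) {E. \<forall>v\<in>S. vdegree E v \<le> t}"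
    by (simp add: t_dependent_def vimage_def)
  also have "\<dots> = measure_pmf.prob ?N {E. \<forall>v\<in>S. vdegree E v \<le> t}"
    by (simp only: map_pmf_induced_edges_gnp[OF assms(1)])
  also have "\<dots> = measure_pmf.prob ?N (bounded_degree_sets t S)"
    by (rule measure_pmf.finite_measure_eq_AE)
       (auto simp: AE_measure_pmf_iff bounded_degree_sets_def)
  also have "\<dots> = (\<Sum>E\<in>bounded_degree_sets t S. pmf ?N E)"
    using fin by (intro measure_measure_pmf_finite finite_bounded_degree_sets)
  also have "\<dots> = dependence_prob p t S"
    unfolding dependence_prob_def using fin assms(2,3)
    by (intro sum.cong refl pmf_random_subset) (auto simp: bounded_degree_sets_def)
  finally show ?thesis .
qed

text \<open>Write the cardinality as a sum of indicators over all \<open>k\<close>-sets and use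
  linearity of expectation.\<close>

lemma expectation_card_dependent_sets:
  assumes "0 \<le> p" "p \<le> 1"
  shows "measure_pmf.expectation (gnp n p) (\<lambda>E. real (card (dependent_sets n t k E)))
    = (\<Sum>S | S \<subseteq> {1..n} \<and> card S = k. dependence_prob p t S)"
proof -
  let ?C = "{S. S \<subseteq> {1..n} \<and> card S = k}"
  have fin: "finite ?C" by (rule finite_subset[of _ "Pow {1..n}"]) auto
  have "dependent_sets n t k E = ?C \<inter> {S. t_dependent E t S}" for E
    by (auto simp: dependent_sets_def)
  hence "real (card (dependent_sets n t k E))
      = (\<Sum>S\<in>?C. indicator {E. t_dependent E t S} E)" for E
    using fin by (simp add: indicator_def sum.If_cases)
  hence "measure_pmf.expectation (gnp n p) (\<lambda>E. real (card (dependent_sets n t k E)))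
      = (\<Sum>S\<in>?C. measure_pmf.prob (gnp n p) {E. t_dependent E t S})"
    by (simp del: One_nat_def, subst Bochner_Integration.integral_sum)
       (auto intro!: measure_pmf.integrable_const_bound[where B = 1])
  also have "\<dots> = (\<Sum>S\<in>?C. dependence_prob p t S)"
    using assms by (intro sum.cong refl prob_t_dependent_gnp) auto
  finally show ?thesis .
qed

section \<open>Bounds for the probability of \<open>t\<close>-dependence at fixed size\<close>

text \<open>Markov's inequality for \<open>w ^ (2 |E|)\<close>; using \<open>w\<^sup>2\<close> as the base keeps the exponent \<open>t k\<close>
  integral.\<close>

lemma dependence_prob_upper:
  fixes p w :: real
  assumes S: "finite S" and p: "0 \<le> p" "p \<le> 1" and w: "0 < w" "w \<le> 1"
  shows "dependence_prob p t S * w ^ (t * card S) \<le> (1 - p + p * w\<^sup>2) ^ (card S choose 2)"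
proof -
  let ?F = "pairs S"
  have "dependence_prob p t S * w ^ (t * card S)
      = (\<Sum>E\<in>bounded_degree_sets t S. subset_weight ?F p E * w ^ (t * card S))"
    by (simp add: dependence_prob_def sum_distrib_right)
  also have "\<dots> \<le> (\<Sum>E\<in>bounded_degree_sets t S. subset_weight ?F p E * (w\<^sup>2) ^ card E)"
  proof (intro sum_mono mult_left_mono subset_weight_nonneg p)
    fix E assume E: "E \<in> bounded_degree_sets t S"
    hence "2 * card E = (\<Sum>v\<in>S. vdegree E v)"
      using S by (simp add: sum_vdegree bounded_degree_sets_def)
    also have "\<dots> \<le> (\<Sum>v\<in>S. t)"
      using E by (intro sum_mono) (auto simp: bounded_degree_sets_def)
    finally have "2 * card E \<le> t * card S" by (simp add: mult.commute)
    thus "w ^ (t * card S) \<le> (w\<^sup>2) ^ card E"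
      using w by (simp add: power_mult[symmetric] power_decreasing)
  qed
  \<comment> \<open>Dropping the degree constraint only adds nonnegative terms and leaves the full
    generating function.\<close>
  also have "\<dots> \<le> (\<Sum>E\<in>Pow ?F. subset_weight ?F p E * (w\<^sup>2) ^ card E)"
    using S p w by (intro sum_mono2 bounded_degree_sets_subset) (auto simp: subset_weight_nonneg)
  also have "\<dots> = (1 - p + p * w\<^sup>2) ^ (card S choose 2)"
    using S by (simp add: sum_subset_weight_power card_pairs)
  finally show ?thesis .
qed

text \<open>The empty graph has all degrees 0. This serves the case \<open>x = 0\<close>, where no
  tilted probability lies strictly between 0 and \<open>x\<close>.\<close>

lemma dependence_prob_ge_empty:
  assumes "finite S" "0 \<le> p" "p \<le> 1"
  shows "(1 - p) ^ (card S choose 2) \<le> dependence_prob p t S"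
proof -
  have "(1 - p) ^ (card S choose 2) = (\<Sum>E\<in>{{}}. subset_weight (pairs S) p E)"
    using assms by (simp add: subset_weight_def card_pairs)
  also have "\<dots> \<le> dependence_prob p t S"
    unfolding dependence_prob_def using assms
    by (intro sum_mono2 finite_bounded_degree_sets subset_weight_nonneg)
       (auto simp: bounded_degree_sets_def vdegree_def)
  finally show ?thesis .
qed

text \<open>Chernoff bound for the degree of \<open>v\<close>, which is binomial with
  \<open>card S - 1\<close> trials: give weight \<open>z\<close> to the pairs containing
  \<open>v\<close> and 1 to all others, so that the product over \<open>E\<close> is
  \<open>z\<close> to the degree.\<close>

lemma degree_tail:
  fixes p z :: real
  assumes S: "finite S" "v \<in> S" and p: "0 \<le> p" "p \<le> 1" and z: "1 \<le> z"
  shows "(\<Sum>E | E \<subseteq> pairs S \<and> t < vdegree E v. subset_weight (pairs S) p E) * z ^ t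
    \<le> (1 - p + p * z) ^ (card S - 1)"
proof -
  let ?F = "pairs S"
  let ?y = "\<lambda>e. if v \<in> e then z else 1"
  have y: "(\<Prod>e\<in>E. ?y e) = z ^ vdegree E v" if "E \<subseteq> ?F" for E
  proof -
    have "finite E" using that S finite_subset finite_pairs by blast
    thus ?thesis by (simp add: prod.If_cases vdegree_def Int_def)
  qed
  have "(\<Sum>E | E \<subseteq> ?F \<and> t < vdegree E v. subset_weight ?F p E) * z ^ t
      \<le> (\<Sum>E | E \<subseteq> ?F \<and> t < vdegree E v. subset_weight ?F p E * (\<Prod>e\<in>E. ?y e))"
    unfolding sum_distrib_right using p z
    by (intro sum_mono mult_left_mono subset_weight_nonneg) (auto simp: y intro!: power_increasing)
  also have "\<dots> \<le> (\<Sum>E\<in>Pow ?F. subset_weight ?F p E * (\<Prod>e\<in>E. ?y e))"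
    using S p z by (intro sum_mono2) (auto simp: y subset_weight_nonneg)
  also have "\<dots> = (\<Prod>e\<in>?F. 1 - p + p * ?y e)"
    using S by (intro sum_subset_weight_prod) simp
  also have "\<dots> = (\<Prod>e\<in>?F. if v \<in> e then 1 - p + p * z else 1)"
    by (intro prod.cong) auto
  also have "\<dots> = (1 - p + p * z) ^ card {e \<in> ?F. v \<in> e}"
    using S by (simp add: prod.If_cases Int_def)
  finally show ?thesis using S by (simp add: card_pairs_containing)
qed

lemma sum_UN_le:
  fixes f :: "'a \<Rightarrow> real"
  assumes "finite I" "\<And>i. finite (A i)" "\<And>x. 0 \<le> f x"
  shows "sum f (\<Union>i\<in>I. A i) \<le> (\<Sum>i\<in>I. sum f (A i))"
  using assms(1)
proof (induction rule: finite_induct)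
  case (insert i I)
  have "sum f (A i \<union> (\<Union>i\<in>I. A i)) \<le> sum f (A i) + sum f (\<Union>i\<in>I. A i)"
    using assms insert.hyps by (subst sum_Un) (auto intro!: sum_nonneg)
  with insert show ?case by simp
qed simp

text \<open>Union bound: if \<open>S\<close> fails to be \<open>t\<close>-dependent, one of its
  vertices has degree above \<open>t\<close>.\<close>

lemma dependence_prob_complement:
  fixes p z :: real
  assumes S: "finite S" and p: "0 \<le> p" "p \<le> 1" and z: "1 \<le> z"
  shows "(1 - dependence_prob p t S) * z ^ t \<le> card S * (1 - p + p * z) ^ (card S - 1)"
proof -
  let ?F = "pairs S" and ?B = "\<lambda>v. {E. E \<subseteq> pairs S \<and> t < vdegree E v}"
  have fin: "finite (?B v)" for v
    by (rule finite_subset[of _ "Pow ?F"]) (use S in auto)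
  have "1 - dependence_prob p t S = (\<Sum>E\<in>Pow ?F - bounded_degree_sets t S. subset_weight ?F p E)"
    using S by (simp add: dependence_prob_def sum_diff bounded_degree_sets_subset sum_subset_weight)
  also have "Pow ?F - bounded_degree_sets t S = (\<Union>v\<in>S. ?B v)"
    by (auto simp: bounded_degree_sets_def not_le)
  also have "(\<Sum>E\<in>(\<Union>v\<in>S. ?B v). subset_weight ?F p E) \<le> (\<Sum>v\<in>S. \<Sum>E\<in>?B v. subset_weight ?F p E)"
    using S p fin by (intro sum_UN_le subset_weight_nonneg) auto
  finally have "(1 - dependence_prob p t S) * z ^ t
      \<le> (\<Sum>v\<in>S. \<Sum>E\<in>?B v. subset_weight ?F p E) * z ^ t"
    using z by (intro mult_right_mono) auto
  also have "\<dots> \<le> (\<Sum>v\<in>S. (1 - p + p * z) ^ (card S - 1))"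
    unfolding sum_distrib_right[of _ S]
    using S p z by (intro sum_mono degree_tail) auto
  finally show ?thesis by simp
qed

section \<open>The rate function and the change of edge probability\<close>

text \<open>The relative entropy of Bernoulli(\<open>x\<close>) with respect to
  Bernoulli(\<open>p\<close>), as a real-valued form of \<open>Lambda_star\<close>. At
  \<open>x = 0\<close> the first product is 0, which gives the intended value.\<close>

definition bernoulli_rate :: "real \<Rightarrow> real \<Rightarrow> real" where
  "bernoulli_rate p x = x * ln (x / p) + (1 - x) * ln ((1 - x) / (1 - p))"

lemma Lambda_star_eq_bernoulli_rate:
  assumes "0 \<le> x" "x < 1"
  shows "real_of_ereal (Lambda_star p x) = bernoulli_rate p x"
  using assms by (auto simp: Lambda_star_def bernoulli_rate_def)

text \<open>This is the coefficient of \<open>card E\<close> in the log-likelihood ratio of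
  \<open>p\<close> against \<open>r\<close>; its sign turns upper bounds on \<open>card E\<close>
  into upper bounds on the ratio.\<close>

lemma log_likelihood_slope_nonneg:
  fixes p r :: real
  assumes "0 < r" "r < p" "p < 1"
  shows "0 \<le> ln (p / r) - ln ((1 - p) / (1 - r))"
proof -
  have "0 \<le> ln (p / r)" using assms by simp
  moreover have "ln ((1 - p) / (1 - r)) \<le> 0" using assms by simp
  ultimately show ?thesis by simp
qed

text \<open>The log-likelihood ratio is affine in \<open>card E\<close>; bounding its exponential below by the tangent
  line \<open>1 + y\<close> means that only the mean of \<open>card E\<close> is needed, not its concentration.\<close>

lemma subset_weight_change_of_measure:
  fixes p r c Q A :: real
  assumes F: "finite F" and D: "D \<subseteq> Pow F"
    and r: "0 < r" "r < p" and p: "p < 1"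
    and Q: "Q = (\<Sum>E\<in>D. subset_weight F r E)"
    and A: "A = ln (p / r) - ln ((1 - p) / (1 - r))"
  shows "exp (- real (card F) * bernoulli_rate p r - c) * ((1 + c) * Q - A * card F * (1 - Q))
    \<le> (\<Sum>E\<in>D. subset_weight F p E)"
proof -
  let ?N = "real (card F)"
  \<comment> \<open>The slack \<open>c\<close> is paid for in the exponent; in return the tangent
    line gains \<open>c * Q\<close>, which can absorb the error
    \<open>A * card F * (1 - Q)\<close>.\<close>
  let ?M = "- ?N * bernoulli_rate p r - c"
  \<comment> \<open>The log-likelihood ratio of \<open>E\<close> is
    \<open>- ?N * bernoulli_rate p r + g E\<close>; thus \<open>g\<close> is its centred version,
    with mean 0 under the weights for \<open>r\<close>.\<close>
  define g where "g E = A * (real (card E) - r * ?N)" for E :: "'a set"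
  have ln_inv: "ln (r / p) = - ln (p / r)" "ln ((1 - r) / (1 - p)) = - ln ((1 - p) / (1 - r))"
    using r p by (simp_all add: ln_div)
  have finD: "finite D" using F D finite_subset by auto
  have A0: "0 \<le> A"
    unfolding A using r p by (rule log_likelihood_slope_nonneg)
  have nn: "0 \<le> subset_weight F r E" for E
    using r p by (intro subset_weight_nonneg) auto
  \<comment> \<open>Since \<open>g\<close> has mean 0, its sum over \<open>D\<close> is minus that
    over the complement, where \<open>g E \<le> A * ?N\<close> and the total weight is
    \<open>1 - Q\<close>.\<close>
  have "A * ?N * (Q - 1) \<le> (\<Sum>E\<in>D. subset_weight F r E * g E)"
  proof -
    have "(\<Sum>E\<in>Pow F. subset_weight F r E * g E)
        = A * (\<Sum>E\<in>Pow F. subset_weight F r E * card E)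
          - A * r * ?N * (\<Sum>E\<in>Pow F. subset_weight F r E)"
      by (simp add: g_def algebra_simps sum_subtractf sum_distrib_left)
    hence "(\<Sum>E\<in>Pow F. subset_weight F r E * g E) = 0"
      using F by (simp add: sum_subset_weight sum_subset_weight_card)
    hence "(\<Sum>E\<in>D. subset_weight F r E * g E) = - (\<Sum>E\<in>Pow F - D. subset_weight F r E * g E)"
      using F D by (simp add: sum_diff)
    moreover have "(\<Sum>E\<in>Pow F - D. subset_weight F r E * g E)
        \<le> (\<Sum>E\<in>Pow F - D. subset_weight F r E * (A * ?N))"
    proof (intro sum_mono mult_left_mono nn)
      fix E assume "E \<in> Pow F - D"
      hence "card E \<le> card F" using F by (auto intro: card_mono)
      moreover have "0 \<le> r * ?N" using r by simp
      ultimately have "real (card E) - r * ?N \<le> ?N" by linarith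
      thus "g E \<le> A * ?N" unfolding g_def using A0 by (intro mult_left_mono) auto
    qed
    moreover have "\<dots> = (1 - Q) * (A * ?N)"
      using F D by (simp add: Q sum_distrib_right[symmetric] sum_diff sum_subset_weight)
    ultimately show ?thesis by (simp add: algebra_simps)
  qed
  hence "exp ?M * ((1 + c) * Q - A * ?N * (1 - Q))
      \<le> exp ?M * ((1 + c) * Q + (\<Sum>E\<in>D. subset_weight F r E * g E))"
    by (intro mult_left_mono) (auto simp: algebra_simps)
  also have "\<dots> = (\<Sum>E\<in>D. subset_weight F r E * (exp ?M * (1 + (c + g E))))"
    by (simp add: Q sum_distrib_left sum.distrib[symmetric] algebra_simps)
  also have "\<dots> \<le> (\<Sum>E\<in>D. subset_weight F r E * (exp ?M * exp (c + g E)))"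
    by (intro sum_mono mult_left_mono nn exp_ge_add_one_self) auto
  also have "\<dots> = (\<Sum>E\<in>D. subset_weight F p E)"
  proof (rule sum.cong[OF refl])
    fix E assume "E \<in> D"
    hence E: "E \<subseteq> F" using D by auto
    have le: "card E \<le> card F" using E F by (rule card_mono[rotated])
    have "exp ?M * exp (c + g E)
        = exp (card E * ln (p / r) + card (F - E) * ln ((1 - p) / (1 - r)))"
      using E F le unfolding exp_add[symmetric] g_def A bernoulli_rate_def ln_inv
      by (simp add: card_Diff_subset finite_subset of_nat_diff algebra_simps)
    also have "\<dots> = (p / r) ^ card E * ((1 - p) / (1 - r)) ^ card (F - E)"
      using r p by (simp add: exp_add exp_of_nat_mult)
    finally show "subset_weight F r E * (exp ?M * exp (c + g E)) = subset_weight F p E"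
      using r p by (simp add: subset_weight_def power_divide)
  qed
  finally show ?thesis .
qed

section \<open>Asymptotic lower bound for the probability of \<open>t\<close>-dependence\<close>

text \<open>Both sides vanish at \<open>z = 1\<close>, and their difference has derivative
  \<open>r - x < 0\<close> there, so any \<open>z\<close> slightly above 1 works.\<close>

lemma exists_chernoff_base:
  fixes r x :: real
  assumes "0 < r" "r < x"
  shows "\<exists>z>1. ln (1 - r + r * z) < x * ln z"
proof -
  have "((\<lambda>z. ln (1 - r + r * z) - x * ln z) has_real_derivative r - x) (at 1)"
    using assms by (auto intro!: derivative_eq_intros)
  from DERIV_neg_dec_right[OF this] assms obtain d where d: "d > 0"
    "\<And>h. 0 < h \<Longrightarrow> h < d \<Longrightarrow> ln (1 - r + r * (1 + h)) - x * ln (1 + h) < 0"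
    by auto
  from d(2)[of "d/2"] d(1) show ?thesis
    by (intro exI[of _ "1 + d/2"]) auto
qed

lemma tendsto_bernoulli_rate:
  assumes "0 < x" "x < 1" "0 < p" "p < 1"
  shows "(bernoulli_rate p \<longlongrightarrow> bernoulli_rate p x) (at_left x)"
  unfolding bernoulli_rate_def[abs_def] using assms
  by (auto intro!: tendsto_eq_intros)

text \<open>The logarithm of the term is \<open>k n\<close> times a quantity tending to
  \<open>ln (1 - r + r * z) - x * ln z < 0\<close>; the factor \<open>k n\<close> from the union
  bound contributes only \<open>ln (k n) / k n\<close> to that quantity.\<close>

lemma degree_tail_tendsto_0:
  fixes r x z :: real and k t :: "nat \<Rightarrow> nat"
  assumes k: "filterlim k at_top at_top" and t: "(\<lambda>n. real (t n) / real (k n)) \<longlonglongrightarrow> x"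
    and r: "0 < r" "r < 1" and z: "1 < z" "ln (1 - r + r * z) < x * ln z"
  shows "(\<lambda>n. real (k n) * (1 - r + r * z) ^ (k n - 1) / z ^ t n) \<longlonglongrightarrow> 0"
proof -
  let ?L = "ln (1 - r + r * z)"
  let ?g = "\<lambda>n. ln (real (k n)) / real (k n) + ?L - ?L / real (k n) - real (t n) / real (k n) * ln z"
  have kr: "filterlim (\<lambda>n. real (k n)) at_top at_top"
    by (rule filterlim_compose[OF filterlim_real_sequentially k])
  have L: "1 - r + r * z > 0" using r z by (intro add_pos_nonneg) auto
  have "?g \<longlonglongrightarrow> 0 + ?L - 0 - x * ln z"
    using filterlim_compose[OF ln_x_over_x_tendsto_0 kr]
      tendsto_divide_0[OF tendsto_const filterlim_at_top_imp_at_infinity[OF kr]] t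
    by (intro tendsto_intros) auto
  moreover have "0 + ?L - 0 - x * ln z < 0" using z by simp
  ultimately have "filterlim (\<lambda>n. ?g n * real (k n)) at_bot at_top"
    using kr by (rule filterlim_tendsto_neg_mult_at_bot)
  hence "(\<lambda>n. exp (?g n * real (k n))) \<longlonglongrightarrow> 0"
    by (rule filterlim_compose[OF exp_at_bot])
  moreover have "\<forall>\<^sub>F n in at_top. exp (?g n * real (k n)) = real (k n) * (1 - r + r * z) ^ (k n - 1) / z ^ t n"
    using eventually_compose_filterlim[OF eventually_ge_at_top[of 1] k]
  proof eventually_elim
    case (elim n)
    hence "?g n * real (k n) = ln (real (k n)) + real (k n - 1) * ?L - real (t n) * ln z"
      by (simp add: field_simps of_nat_diff)
    moreover have "exp (real (k n - 1) * ?L) = (1 - r + r * z) ^ (k n - 1)"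
      using L by (subst exp_of_nat_mult) simp
    ultimately show ?case using elim L z by (simp add: exp_diff exp_add exp_of_nat_mult)
  qed
  ultimately show ?thesis by (rule Lim_transform_eventually)
qed

lemma dependence_prob_lower:
  fixes p x \<delta> :: real and k t :: "nat \<Rightarrow> nat"
  assumes k: "filterlim k at_top at_top" and t: "(\<lambda>n. real (t n) / real (k n)) \<longlonglongrightarrow> x"
    and x: "0 \<le> x" "x < p" and p: "p < 1" and \<delta>: "0 < \<delta>"
  shows "\<forall>\<^sub>F n in at_top. \<forall>S. finite S \<and> card S = k n \<longrightarrow>
    exp (- real (k n choose 2) * (bernoulli_rate p x + \<delta>)) / 2 \<le> dependence_prob p (t n) S"
proof (cases "x = 0")
  case True
  show ?thesis
  proof (intro always_eventually allI impI)
    fix n and S :: "nat set" assume S: "finite S \<and> card S = k n"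
    have "exp (- real (k n choose 2) * (bernoulli_rate p x + \<delta>)) / 2
        \<le> exp (- real (k n choose 2) * (bernoulli_rate p x + \<delta>))" by simp
    also have "\<dots> \<le> exp (- real (k n choose 2) * bernoulli_rate p x)"
      using \<delta> by (simp add: mult_left_mono)
    also have "\<dots> = (1 - p) ^ (k n choose 2)"
      using True p by (simp add: bernoulli_rate_def ln_div exp_of_nat_mult)
    also have "\<dots> \<le> dependence_prob p (t n) S"
      using dependence_prob_ge_empty[of S p "t n"] S x p by simp
    finally show "exp (- real (k n choose 2) * (bernoulli_rate p x + \<delta>)) / 2 \<le> dependence_prob p (t n) S" .
  qed
next
  case False
  with x have x0: "0 < x" by simp
  \<comment> \<open>Half of \<delta> pays for replacing \<open>x\<close> by \<open>r\<close>; the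
    other half becomes the slack in the change of measure.\<close>
  have "\<forall>\<^sub>F r in at_left x. bernoulli_rate p r < bernoulli_rate p x + \<delta> / 2"
    using tendsto_bernoulli_rate[of x p] x0 x p \<delta> by (intro order_tendstoD) auto
  moreover have "\<forall>\<^sub>F r in at_left x. 0 < r \<and> r < x"
    using x0 by (simp add: eventually_at_left_field) (metis)
  ultimately have "\<forall>\<^sub>F r in at_left x. bernoulli_rate p r < bernoulli_rate p x + \<delta> / 2 \<and> 0 < r \<and> r < x"
    by eventually_elim auto
  then obtain r where r: "bernoulli_rate p r < bernoulli_rate p x + \<delta> / 2" "0 < r" "r < x"
    using eventually_happens trivial_limit_at_left_real by blast
  obtain z where z: "1 < z" "ln (1 - r + r * z) < x * ln z"
    using exists_chernoff_base[OF r(2,3)] by blast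
  define A where "A = ln (p / r) - ln ((1 - p) / (1 - r))"
  have A0: "0 \<le> A"
    unfolding A_def using r x p by (intro log_likelihood_slope_nonneg) auto
  \<comment> \<open>\<open>u n\<close> bounds the probability, at edge probability \<open>r\<close>,
    that a given \<open>k n\<close>-set is not \<open>t n\<close>-dependent.\<close>
  define u where "u n = real (k n) * (1 - r + r * z) ^ (k n - 1) / z ^ t n" for n
  have u: "u \<longlonglongrightarrow> 0"
    unfolding u_def[abs_def] using r x p z by (intro degree_tail_tendsto_0[OF k t]) auto
  have "\<forall>\<^sub>F n in at_top. u n < 1/2"
    using u by (rule order_tendstoD) simp
  moreover have "\<forall>\<^sub>F n in at_top. (A + 1) * u n < \<delta> / 4"
    using tendsto_mult_right_zero[OF u, of "A + 1"] \<delta> by (intro order_tendstoD) auto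
  ultimately show ?thesis
  proof eventually_elim
    case (elim n)
    show ?case
    proof (intro allI impI)
      fix S :: "nat set" assume S: "finite S \<and> card S = k n"
      define N where "N = real (k n choose 2)"
      define Q where "Q = dependence_prob r (t n) S"
      have N: "0 \<le> N" by (simp add: N_def)
      have "(1 - Q) * z ^ t n \<le> real (k n) * (1 - r + r * z) ^ (k n - 1)"
        using dependence_prob_complement[of S r z "t n"] S r x p z by (simp add: Q_def)
      hence Qu: "1 - Q \<le> u n"
        using z by (simp add: u_def pos_le_divide_eq)
      have "A * (1 - Q) \<le> A * u n" using Qu A0 by (rule mult_left_mono)
      moreover have "0 \<le> u n" using r x p z by (simp add: u_def)
      ultimately have AQ: "A * (1 - Q) \<le> \<delta> / 4" using elim by (simp add: algebra_simps)
      have "1/2 \<le> Q" using Qu elim by simp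
      \<comment> \<open>The slack \<open>c = \<delta> / 2 * N\<close> with
        \<open>Q \<ge> 1/2\<close> gains at least \<open>\<delta> / 4 * N\<close>, which covers the
        error \<open>A * N * (1 - Q)\<close>; the remaining \<open>1/2\<close> is the constant in
        the claim.\<close>
      hence "(1 + \<delta> / 2 * N) * (1/2) \<le> (1 + \<delta> / 2 * N) * Q"
        using N \<delta> by (intro mult_left_mono) auto
      moreover have "A * N * (1 - Q) \<le> \<delta> / 4 * N"
        using mult_right_mono[OF AQ N] by (simp add: mult_ac)
      ultimately have half: "1/2 \<le> (1 + \<delta> / 2 * N) * Q - A * N * (1 - Q)"
        by (simp add: algebra_simps)
      have "N * (bernoulli_rate p r + \<delta> / 2) \<le> N * (bernoulli_rate p x + \<delta>)"
        using r N by (intro mult_left_mono) auto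
      hence "exp (- N * (bernoulli_rate p x + \<delta>)) * (1/2) \<le> exp (- N * bernoulli_rate p r - \<delta> / 2 * N) * (1/2)"
        by (simp add: algebra_simps)
      also have "\<dots> \<le> exp (- N * bernoulli_rate p r - \<delta> / 2 * N) * ((1 + \<delta> / 2 * N) * Q - A * N * (1 - Q))"
        using half by (intro mult_left_mono) auto
      also have "\<dots> \<le> dependence_prob p (t n) S"
        using subset_weight_change_of_measure[of "pairs S" "bounded_degree_sets (t n) S" r p Q A "\<delta> / 2 * N"]
          S r x p bounded_degree_sets_subset
        by (simp add: A_def Q_def dependence_prob_def N_def card_pairs)
      finally show "exp (- real (k n choose 2) * (bernoulli_rate p x + \<delta>)) / 2 \<le> dependence_prob p (t n) S"
        by (simp add: N_def)
    qed
  qed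
qed

section \<open>Optimal weight for the upper bound\<close>

lemma exists_markov_weight:
  fixes p x \<delta> :: real
  assumes "0 \<le> x" "x < p" "p < 1" "0 < \<delta>"
  shows "\<exists>w. 0 < w \<and> w \<le> 1 \<and> ln (1 - p + p * w\<^sup>2) - 2 * x * ln w < - bernoulli_rate p x + \<delta>"
proof (cases "x = 0")
  case True
  \<comment> \<open>For \<open>x = 0\<close> the infimum is approached only as \<open>w\<close>
    tends to 0, hence the tolerance \<delta>.\<close>
  have "((\<lambda>w. ln (1 - p + p * w\<^sup>2)) \<longlongrightarrow> - bernoulli_rate p x) (at_right 0)"
    using True assms by (auto intro!: tendsto_eq_intros simp: bernoulli_rate_def ln_div)
  hence "\<forall>\<^sub>F w in at_right 0. ln (1 - p + p * w\<^sup>2) < - bernoulli_rate p x + \<delta>"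
    using assms by (intro order_tendstoD) auto
  moreover have "\<forall>\<^sub>F w in at_right (0::real). 0 < w \<and> w < 1"
    by (simp add: eventually_at_right_field) (metis zero_less_one)
  ultimately have "\<forall>\<^sub>F w in at_right 0. ln (1 - p + p * w\<^sup>2) < - bernoulli_rate p x + \<delta> \<and> 0 < w \<and> w < 1"
    by eventually_elim auto
  then obtain w where "ln (1 - p + p * w\<^sup>2) < - bernoulli_rate p x + \<delta>" "0 < w" "w < 1"
    using eventually_happens trivial_limit_at_right_real by blast
  thus ?thesis using True by (intro exI[of _ w]) auto
next
  case False
  \<comment> \<open>The critical point of \<open>ln (1 - p + p * y) - x * ln y\<close>, where
    \<open>y\<close> stands for the square of \<open>w\<close>; \<open>x < p\<close> ensures
    \<open>y \<le> 1\<close>.\<close>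
  define y where "y = x * (1 - p) / (p * (1 - x))"
  have y: "0 < y" "y \<le> 1" using False assms by (auto simp: y_def field_simps)
  have "1 - p + p * y = (1 - p) / (1 - x)"
    using False assms by (simp add: y_def field_simps)
  moreover have "2 * x * ln (sqrt y) = x * ln y" using y by (simp add: ln_sqrt)
  moreover have "ln y = ln x + ln (1 - p) - ln p - ln (1 - x)"
    using False assms by (simp add: y_def ln_div ln_mult)
  ultimately have "ln (1 - p + p * (sqrt y)\<^sup>2) - 2 * x * ln (sqrt y) = - bernoulli_rate p x"
    using y False assms by (simp only: real_sqrt_pow2 bernoulli_rate_def) (simp add: ln_div algebra_simps)
  thus ?thesis using y assms by (intro exI[of _ "sqrt y"]) auto
qed

section \<open>Logarithmic asymptotics of the expectation\<close>

text \<open>The binomial coefficient lies between \<open>(n / k) ^ k\<close> and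
  \<open>n ^ k\<close>; since \<open>k\<close> is of order \<open>ln n\<close>, the loss
  \<open>ln k / ln n\<close> tends to 0.\<close>

lemma ln_binomial_tendsto:
  fixes k :: "nat \<Rightarrow> nat" and \<kappa> :: real
  assumes k: "filterlim k at_top at_top" and kl: "(\<lambda>n. real (k n) / ln (real n)) \<longlonglongrightarrow> \<kappa>"
    and le: "\<forall>\<^sub>F n in at_top. k n \<le> n"
  shows "(\<lambda>n. ln (real (n choose k n)) / (real (k n) * ln (real n))) \<longlonglongrightarrow> 1"
proof (rule tendsto_sandwich)
  have kr: "filterlim (\<lambda>n. real (k n)) at_top at_top"
    by (rule filterlim_compose[OF filterlim_real_sequentially k])
  have k1: "\<forall>\<^sub>F n in at_top. 1 \<le> k n"
    by (rule eventually_compose_filterlim[OF eventually_ge_at_top[of 1] k])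
  have "(\<lambda>n. 1 - ln (real (k n)) / real (k n) * (real (k n) / ln (real n))) \<longlonglongrightarrow> 1 - 0 * \<kappa>"
    by (intro tendsto_intros kl filterlim_compose[OF ln_x_over_x_tendsto_0 kr])
  moreover have "\<forall>\<^sub>F n in at_top. 1 - ln (real (k n)) / real (k n) * (real (k n) / ln (real n))
      = 1 - ln (real (k n)) / ln (real n)"
    using k1 by eventually_elim simp
  ultimately show "(\<lambda>n. 1 - ln (real (k n)) / ln (real n)) \<longlonglongrightarrow> 1"
    by (simp add: Lim_transform_eventually)
  show "\<forall>\<^sub>F n in at_top. 1 - ln (real (k n)) / ln (real n)
      \<le> ln (real (n choose k n)) / (real (k n) * ln (real n))"
    using k1 le eventually_gt_at_top[of 1]
  proof eventually_elim
    case (elim n)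
    have "(real n / real (k n)) ^ k n \<le> real (n choose k n)"
      using elim by (intro binomial_ge_n_over_k_pow_k)
    hence "ln ((real n / real (k n)) ^ k n) \<le> ln (real (n choose k n))"
      using elim by (subst ln_le_cancel_iff) auto
    hence "real (k n) * (ln (real n) - ln (real (k n))) \<le> ln (real (n choose k n))"
      using elim by (simp add: ln_realpow ln_div)
    hence "real (k n) * (ln (real n) - ln (real (k n))) / (real (k n) * ln (real n))
        \<le> ln (real (n choose k n)) / (real (k n) * ln (real n))"
      using elim by (intro divide_right_mono) auto
    thus ?case using elim by (simp add: diff_divide_distrib)
  qed
  show "\<forall>\<^sub>F n in at_top. ln (real (n choose k n)) / (real (k n) * ln (real n)) \<le> 1"
    using k1 le eventually_gt_at_top[of 1]
  proof eventually_elim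
    case (elim n)
    have "real (n choose k n) \<le> real n ^ k n"
      using binomial_le_pow[of "k n" n] elim by (metis of_nat_le_iff of_nat_power)
    hence "ln (real (n choose k n)) \<le> ln (real n ^ k n)"
      using elim by (subst ln_le_cancel_iff) auto
    thus ?case using elim by (simp add: ln_realpow)
  qed
qed auto

lemma ln_expectation_tendsto:
  fixes p \<tau> \<kappa> :: real and t k :: "nat \<Rightarrow> nat"
  assumes p: "0 < p" "p < 1" and \<tau>: "0 \<le> \<tau>" and \<kappa>: "\<tau> / p < \<kappa>"
    and t: "(\<lambda>n. real (t n) / ln (real n)) \<longlonglongrightarrow> \<tau>"
    and kl: "(\<lambda>n. real (k n) / ln (real n)) \<longlonglongrightarrow> \<kappa>"
    and k: "filterlim k at_top at_top"
  defines "X \<equiv> \<lambda>n. \<Sum>S | S \<subseteq> {1..n} \<and> card S = k n. dependence_prob p (t n) S"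
  shows "\<forall>\<^sub>F n in at_top. 0 < X n"
    and "(\<lambda>n. ln (X n) / (real (k n) * ln (real n))) \<longlonglongrightarrow> 1 - \<kappa> / 2 * bernoulli_rate p (\<tau> / \<kappa>)"
proof -
  define x where "x = \<tau> / \<kappa>"
  have "0 \<le> \<tau> / p" using \<tau> p by simp
  hence \<kappa>0: "0 < \<kappa>" using \<kappa> by linarith
  have x: "0 \<le> x" "x < p" using \<tau> \<kappa>0 \<kappa> p by (auto simp: x_def field_simps)
  have k1: "\<forall>\<^sub>F n in at_top. 1 \<le> k n"
    by (rule eventually_compose_filterlim[OF eventually_ge_at_top[of 1] k])
  have lnt: "filterlim (\<lambda>n. ln (real n)) at_top at_top"
    by (rule filterlim_compose[OF ln_at_top filterlim_real_sequentially])
  \<comment> \<open>\<open>k n / n\<close> tends to 0; \<open>k n \<le> n\<close> keeps the binomial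
    coefficient positive, so its logarithm is meaningful.\<close>
  have kle: "\<forall>\<^sub>F n in at_top. k n \<le> n"
  proof -
    have "(\<lambda>n. real (k n) / ln (real n) * (ln (real n) / real n)) \<longlonglongrightarrow> \<kappa> * 0"
      by (intro tendsto_intros kl filterlim_compose[OF ln_x_over_x_tendsto_0 filterlim_real_sequentially])
    hence "\<forall>\<^sub>F n in at_top. real (k n) / ln (real n) * (ln (real n) / real n) < 1"
      by (rule order_tendstoD) simp
    thus ?thesis using eventually_gt_at_top[of 1]
      by eventually_elim (simp add: field_simps)
  qed
  have tk: "(\<lambda>n. real (t n) / real (k n)) \<longlonglongrightarrow> x"
  proof -
    have "(\<lambda>n. (real (t n) / ln (real n)) / (real (k n) / ln (real n))) \<longlonglongrightarrow> \<tau> / \<kappa>"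
      using \<kappa>0 by (intro tendsto_intros t kl) auto
    moreover have "\<forall>\<^sub>F n in at_top. (real (t n) / ln (real n)) / (real (k n) / ln (real n)) = real (t n) / real (k n)"
      using eventually_gt_at_top[of 1] by eventually_elim simp
    ultimately show ?thesis unfolding x_def by (rule Lim_transform_eventually)
  qed
  define B where "B n = ln (real (n choose k n)) / (real (k n) * ln (real n))" for n
  \<comment> \<open>After division by \<open>k ln n\<close>, the binomial coefficient contributes
    \<open>B n\<close>, and each unit of exponent per pair contributes \<open>N n\<close>.\<close>
  define N where "N n = real (k n choose 2) / (real (k n) * ln (real n))" for n
  have B: "B \<longlonglongrightarrow> 1"
    unfolding B_def[abs_def] by (rule ln_binomial_tendsto[OF k kl kle])
  have inv: "(\<lambda>n. c / ln (real n)) \<longlonglongrightarrow> 0" for c :: real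
    by (rule tendsto_divide_0[OF tendsto_const filterlim_at_top_imp_at_infinity[OF lnt]])
  have N: "N \<longlonglongrightarrow> \<kappa> / 2"
  proof -
    have "(\<lambda>n. (real (k n) / ln (real n) - 1 / ln (real n)) / 2) \<longlonglongrightarrow> (\<kappa> - 0) / 2"
      by (intro tendsto_intros kl inv) auto
    moreover have "\<forall>\<^sub>F n in at_top. (real (k n) / ln (real n) - 1 / ln (real n)) / 2 = N n"
      using eventually_gt_at_top[of 1] k1
    proof eventually_elim
      case (elim n)
      have "2 * (k n choose 2) = k n * (k n - 1)" by (cases "k n") (simp_all add: choose_two)
      hence "real (2 * (k n choose 2)) = real (k n * (k n - 1))" by (rule arg_cong)
      hence "real (k n choose 2) = real (k n) * (real (k n) - 1) / 2"
        using elim by (simp add: of_nat_diff)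
      hence "N n = real (k n) * (real (k n) - 1) / 2 / (real (k n) * ln (real n))"
        by (simp only: N_def)
      thus ?case using elim by (simp add: diff_divide_distrib)
    qed
    ultimately show ?thesis using Lim_transform_eventually by fastforce
  qed
  have C: "card {S. S \<subseteq> {1..n} \<and> card S = k n} = n choose k n" for n
    using n_subsets[of "{1..n}" "k n"] by simp
  have Xge: "\<forall>\<^sub>F n in at_top. real (n choose k n) * (exp (- real (k n choose 2) * (bernoulli_rate p x + \<delta>)) / 2) \<le> X n"
    if "0 < \<delta>" for \<delta>
    using dependence_prob_lower[OF k tk x p(2) that]
  proof eventually_elim
    case (elim n)
    have "(\<Sum>S | S \<subseteq> {1..n} \<and> card S = k n. exp (- real (k n choose 2) * (bernoulli_rate p x + \<delta>)) / 2) \<le> X n"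
      unfolding X_def using elim finite_subset by (intro sum_mono) blast
    thus ?case by (simp only: sum_constant C)
  qed
  \<comment> \<open>The factor \<open>1/2\<close> in the lower bound becomes the \<open>ln 2\<close>
    term, which vanishes after division by \<open>k ln n\<close>.\<close>
  have lower: "\<forall>\<^sub>F n in at_top. 0 < X n \<and>
      B n - N n * (bernoulli_rate p x + \<delta>) - ln 2 / ln (real n) / real (k n)
        \<le> ln (X n) / (real (k n) * ln (real n))" if "0 < \<delta>" for \<delta>
    using Xge[OF that] k1 kle eventually_gt_at_top[of 1]
  proof eventually_elim
    case (elim n)
    let ?e = "real (n choose k n) * (exp (- real (k n choose 2) * (bernoulli_rate p x + \<delta>)) / 2)"
    have c: "0 < real (n choose k n)" using elim by simp
    hence "0 < ?e" by simp
    hence pos: "0 < X n" using elim by linarith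
    have "ln (real (n choose k n)) - real (k n choose 2) * (bernoulli_rate p x + \<delta>) - ln 2 = ln ?e"
      using c by (simp add: ln_mult ln_div)
    also have "\<dots> \<le> ln (X n)" using elim \<open>0 < ?e\<close> pos by (subst ln_le_cancel_iff)
    finally have "(ln (real (n choose k n)) - real (k n choose 2) * (bernoulli_rate p x + \<delta>) - ln 2)
        / (real (k n) * ln (real n)) \<le> ln (X n) / (real (k n) * ln (real n))"
      using elim by (intro divide_right_mono) auto
    thus ?case using pos by (simp add: B_def N_def diff_divide_distrib mult.commute)
  qed
  show pos: "\<forall>\<^sub>F n in at_top. 0 < X n"
    using lower[OF zero_less_one] by eventually_elim simp
  \<comment> \<open>The weight \<open>w\<close> stays fixed here and is optimised only after passing
    to the limit; \<open>w ^ (t k)\<close> contributes \<open>t k ln w\<close>, normalised to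
    \<open>(t / ln n) ln w\<close>.\<close>
  have upper: "\<forall>\<^sub>F n in at_top. ln (X n) / (real (k n) * ln (real n))
      \<le> B n + N n * ln (1 - p + p * w\<^sup>2) - real (t n) / ln (real n) * ln w"
    if w: "0 < w" "w \<le> 1" for w
    using pos k1 kle eventually_gt_at_top[of 1]
  proof eventually_elim
    case (elim n)
    have q: "0 < 1 - p + p * w\<^sup>2" using p by (intro add_pos_nonneg) auto
    have c: "0 < real (n choose k n)" using elim by simp
    let ?e = "(1 - p + p * w\<^sup>2) ^ (k n choose 2) / w ^ (t n * k n)"
    have "X n \<le> (\<Sum>S | S \<subseteq> {1..n} \<and> card S = k n. ?e)"
      unfolding X_def
    proof (rule sum_mono)
      fix S assume "S \<in> {S. S \<subseteq> {1..n} \<and> card S = k n}"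
      hence "finite S" "card S = k n" using finite_subset by auto
      with dependence_prob_upper[of S p w "t n"] p w show "dependence_prob p (t n) S \<le> ?e"
        by (simp add: pos_le_divide_eq)
    qed
    hence "X n \<le> real (n choose k n) * ?e" by (simp only: sum_constant C)
    hence "ln (X n) \<le> ln (real (n choose k n) * ?e)"
      using elim(1) c q w by (subst ln_le_cancel_iff) auto
    also have "\<dots> = ln (real (n choose k n)) + real (k n choose 2) * ln (1 - p + p * w\<^sup>2)
        - real (t n) * real (k n) * ln w"
      using c q w by (simp add: ln_mult ln_div ln_realpow)
    finally have "ln (X n) / (real (k n) * ln (real n)) \<le> (ln (real (n choose k n))
        + real (k n choose 2) * ln (1 - p + p * w\<^sup>2) - real (t n) * real (k n) * ln w) / (real (k n) * ln (real n))"
      using elim by (intro divide_right_mono) auto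
    thus ?case using elim by (simp add: B_def N_def diff_divide_distrib add_divide_distrib)
  qed
  show "(\<lambda>n. ln (X n) / (real (k n) * ln (real n))) \<longlonglongrightarrow> 1 - \<kappa> / 2 * bernoulli_rate p (\<tau> / \<kappa>)"
    unfolding x_def[symmetric]
  proof (rule order_tendstoI)
    fix a assume a: "a < 1 - \<kappa> / 2 * bernoulli_rate p x"
    \<comment> \<open>With this choice the perturbation \<open>\<kappa> * \<delta> / 2\<close> of
      the limit is half of the gap to \<open>a\<close>.\<close>
    define \<delta> where "\<delta> = (1 - \<kappa> / 2 * bernoulli_rate p x - a) / \<kappa>"
    have \<delta>: "0 < \<delta>" using a \<kappa>0 by (simp add: \<delta>_def)
    have "\<kappa> * \<delta> = 1 - \<kappa> / 2 * bernoulli_rate p x - a" using \<kappa>0 by (simp add: \<delta>_def)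
    moreover have "0 < \<kappa> * \<delta>" using \<kappa>0 \<delta> by simp
    moreover have "\<kappa> / 2 * (bernoulli_rate p x + \<delta>) = \<kappa> / 2 * bernoulli_rate p x + \<kappa> * \<delta> / 2"
      by (simp add: algebra_simps)
    ultimately have lim: "a < 1 - \<kappa> / 2 * (bernoulli_rate p x + \<delta>) - 0" by linarith
    have "(\<lambda>n. ln 2 / ln (real n) / real (k n)) \<longlonglongrightarrow> 0"
      by (rule tendsto_divide_0[OF inv])
         (rule filterlim_at_top_imp_at_infinity[OF filterlim_compose[OF filterlim_real_sequentially k]])
    hence "(\<lambda>n. B n - N n * (bernoulli_rate p x + \<delta>) - ln 2 / ln (real n) / real (k n))
        \<longlonglongrightarrow> 1 - \<kappa> / 2 * (bernoulli_rate p x + \<delta>) - 0"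
      by (intro tendsto_intros B N)
    from order_tendstoD(1)[OF this lim] lower[OF \<delta>]
    show "\<forall>\<^sub>F n in at_top. a < ln (X n) / (real (k n) * ln (real n))"
      by eventually_elim linarith
  next
    fix a assume a: "1 - \<kappa> / 2 * bernoulli_rate p x < a"
    define \<delta> where "\<delta> = (a - (1 - \<kappa> / 2 * bernoulli_rate p x)) / \<kappa>"
    have \<delta>: "0 < \<delta>" using a \<kappa>0 by (simp add: \<delta>_def)
    obtain w where w: "0 < w" "w \<le> 1" "ln (1 - p + p * w\<^sup>2) - 2 * x * ln w < - bernoulli_rate p x + \<delta>"
      using exists_markov_weight[OF x p(2) \<delta>] by blast
    have "\<kappa> / 2 * (ln (1 - p + p * w\<^sup>2) - 2 * x * ln w) < \<kappa> / 2 * (- bernoulli_rate p x + \<delta>)"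
      using w \<kappa>0 by (intro mult_strict_left_mono) auto
    moreover have "\<kappa> * \<delta> = a - (1 - \<kappa> / 2 * bernoulli_rate p x)" using \<kappa>0 by (simp add: \<delta>_def)
    moreover have "0 < \<kappa> * \<delta>" using \<kappa>0 \<delta> by simp
    \<comment> \<open>This identifies the Markov exponent at \<open>x\<close> with the limit of the
      normalised upper bound, where \<open>t / ln n\<close> tends to \<tau>.\<close>
    moreover have "\<kappa> * (x * ln w) = \<tau> * ln w" using \<kappa>0 by (simp add: x_def)
    moreover have "\<kappa> / 2 * (- bernoulli_rate p x + \<delta>) = \<kappa> * \<delta> / 2 - \<kappa> / 2 * bernoulli_rate p x"
      by (simp add: field_simps)
    moreover have "\<kappa> / 2 * (ln (1 - p + p * w\<^sup>2) - 2 * x * ln w)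
        = \<kappa> / 2 * ln (1 - p + p * w\<^sup>2) - \<kappa> * (x * ln w)"
      by (simp add: algebra_simps)
    ultimately have lim: "1 + \<kappa> / 2 * ln (1 - p + p * w\<^sup>2) - \<tau> * ln w < a"
      by linarith
    have "(\<lambda>n. B n + N n * ln (1 - p + p * w\<^sup>2) - real (t n) / ln (real n) * ln w)
        \<longlonglongrightarrow> 1 + \<kappa> / 2 * ln (1 - p + p * w\<^sup>2) - \<tau> * ln w"
      by (intro tendsto_intros B N t)
    from order_tendstoD(2)[OF this lim] upper[OF w(1,2)]
    show "\<forall>\<^sub>F n in at_top. ln (X n) / (real (k n) * ln (real n)) < a"
      by eventually_elim linarith
  qed
qed

section \<open>From the limit of the logarithm to the error term\<close>

theorem theorem7:
  fixes p \<tau> \<kappa> :: real and t k :: "nat \<Rightarrow> nat"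
  assumes "0 < p" and "p < 1"
    and "0 \<le> \<tau>" and "0 \<le> \<kappa>" and "\<tau> / p < \<kappa>"
    and "(\<lambda>n. real (t n) / ln (real n)) \<longlonglongrightarrow> \<tau>"
    and "(\<lambda>n. real (k n)) \<sim>[at_top] (\<lambda>n. \<kappa> * ln (real n))"
  shows "\<exists>\<epsilon> :: nat \<Rightarrow> real. \<epsilon> \<in> o(\<lambda>_. 1) \<and>
    (\<forall>\<^sub>F n in at_top.
      measure_pmf.expectation (gnp n p) (\<lambda>E. real (card (dependent_sets n (t n) (k n) E)))
      = exp (real (k n) * ln (real n) *
          (1 - \<kappa> / 2 * real_of_ereal (Lambda_star p (\<tau> / \<kappa>)) + \<epsilon> n)))"
proof -
  have "0 \<le> \<tau> / p" using assms(1,3) by simp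
  hence \<kappa>0: "0 < \<kappa>" using assms(5) by linarith
  have "\<tau> / \<kappa> < p" using \<kappa>0 assms(1,5) by (simp add: field_simps)
  hence x: "0 \<le> \<tau> / \<kappa>" "\<tau> / \<kappa> < 1"
    using \<kappa>0 assms(2,3) by (simp, linarith)
  have lnt: "filterlim (\<lambda>n. ln (real n)) at_top at_top"
    by (rule filterlim_compose[OF ln_at_top filterlim_real_sequentially])
  have kl: "(\<lambda>n. real (k n) / ln (real n)) \<longlonglongrightarrow> \<kappa>"
  proof -
    \<comment> \<open>Asymptotic equivalence reads \<open>0 / 0\<close> as 1; for
      \<open>n > 1\<close> the denominator is nonzero, so the ratio is the genuine one.\<close>
    have "\<forall>\<^sub>F n in at_top. real (k n) \<noteq> 0 \<or> \<kappa> * ln (real n) \<noteq> 0"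
      using eventually_gt_at_top[of 1] by eventually_elim (use \<kappa>0 in simp)
    hence "(\<lambda>n. real (k n) / (\<kappa> * ln (real n))) \<longlonglongrightarrow> 1"
      by (rule asymp_equivD_strong[OF assms(7)])
    hence "(\<lambda>n. \<kappa> * (real (k n) / (\<kappa> * ln (real n)))) \<longlonglongrightarrow> \<kappa> * 1"
      by (intro tendsto_intros)
    thus ?thesis using \<kappa>0 by simp
  qed
  have "filterlim (\<lambda>n. \<kappa> * ln (real n)) at_top at_top"
    by (rule filterlim_tendsto_pos_mult_at_top[OF tendsto_const \<kappa>0 lnt])
  hence "filterlim (\<lambda>n. real (k n)) at_top at_top"
    using asymp_equiv_at_top_transfer[OF asymp_equiv_symI[OF assms(7)]] by blast
  hence k: "filterlim k at_top at_top"
    by (simp add: filterlim_sequentially_iff_filterlim_real)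
  let ?X = "\<lambda>n. \<Sum>S | S \<subseteq> {1..n} \<and> card S = k n. dependence_prob p (t n) S"
  let ?L = "1 - \<kappa> / 2 * real_of_ereal (Lambda_star p (\<tau> / \<kappa>))"
  \<comment> \<open>The error is what makes the formula exact wherever \<open>?X n > 0\<close> and
    \<open>k n * ln n\<close> is nonzero, which holds eventually.\<close>
  define \<epsilon> where "\<epsilon> n = ln (?X n) / (real (k n) * ln (real n)) - ?L" for n
  note lims = ln_expectation_tendsto[OF assms(1-3,5,6) kl k]
  have "\<epsilon> \<longlonglongrightarrow> 0"
    unfolding \<epsilon>_def[abs_def] Lambda_star_eq_bernoulli_rate[OF x]
    using lims(2) by (rule LIM_zero)
  hence "\<epsilon> \<in> o(\<lambda>_. 1)" by (intro smalloI_tendsto) auto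
  moreover have "\<forall>\<^sub>F n in at_top.
      measure_pmf.expectation (gnp n p) (\<lambda>E. real (card (dependent_sets n (t n) (k n) E)))
      = exp (real (k n) * ln (real n) * (?L + \<epsilon> n))"
    using lims(1) eventually_gt_at_top[of 1]
      eventually_compose_filterlim[OF eventually_ge_at_top[of 1] k]
  proof eventually_elim
    case (elim n)
    hence "real (k n) * ln (real n) * (?L + \<epsilon> n) = ln (?X n)"
      by (simp add: \<epsilon>_def)
    thus ?case
      using elim assms(1,2) by (simp add: expectation_card_dependent_sets del: One_nat_def)
  qed
  ultimately show ?thesis by blast
qed

end
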